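(* Let $G$ be a finite group and let $H \le G$ be an abelian subgroup. The Zak transform $Z \colon L^2(G) \to \int_{\hat H}^{\oplus} \mathcal{F}_\alpha\, d\alpha$, defined for $f \in L^2(G)$, $\alpha \in \hat H$, $x \in G$ by $$(Zf)(\alpha)(x) = \sum_{h \in H} f(xh)\,\alpha(h),$$ is a unitary operator that intertwines the left regular representation of $G$ on $L^2(G)$ with the representation $\int_{\hat H}^{\oplus} \operatorname{ind}_H^G \alpha\, d\alpha$.
   Context: $\hat H$ is the Pontryagin dual of $H$, i.e. the group of characters (homomorphisms) $\alpha \colon H \to \mathbb{T}$ under pointwise multiplication. $\Omega \subseteq G$ is a fixed transversal for $G/H$ (left cosets $xH$). $L^2(G)$ is the space of complex functions on $G$ with inner product $\langle f,g\rangle = \sum_{x\in G} f(x)\overline{g(x)}$ (counting measure). The left regular representation is $(L_x f)(y) = f(x^{-1}y)$. For $\alpha \in \hat H$, $\mathcal{F}_\alpha = \{ f \in L^2(G) : f(xh) = \overline{\alpha(h)} f(x) \ \forall x \in G,\, h \in H\}$ with inner product $$\langle f,g\rangle_{\mathcal{F}_\alpha} = \frac{1}{|H|}\sum_{x\in G} f(x)\overline{g(x)} = \sum_{x \in \Omega} f(x)\overline{g(x)}.$$ The induced representation $\operatorname{ind}_H^G\alpha \colon G \to U(\mathcal{F}_\alpha)$ is $[(\operatorname{ind}_H^G \alpha)(x) f](y) = f(x^{-1}y)$ for $f \in \mathcal{F}_\alpha$, $x,y\in G$. The direct integral $\int_{\hat H}^{\oplus} \mathcal{F}_\alpha\, d\alpha$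 is the Hilbert space of functions $\varphi \colon \hat H \to L^2(G)$ such that $\varphi(\alpha) \in \mathcal{F}_\alpha$ for every $\alpha \in \hat H$, with inner product $\langle \varphi,\psi\rangle = \frac{1}{|\hat H|}\sum_{\alpha\in\hat H} \langle \varphi(\alpha),\psi(\alpha)\rangle_{\mathcal{F}_\alpha}$. The representation $\int_{\hat H}^{\oplus} \operatorname{ind}_H^G \alpha\, d\alpha$ of $G$ on this space acts coordinatewise: $\left[\left(\int_{\hat H}^{\oplus} \operatorname{ind}_H^G \alpha\, d\alpha\right)(x)\varphi\right](\beta) = (\operatorname{ind}_H^G\beta)(x)[\varphi(\beta)]$ for $x\in G$, $\beta\in\hat H$. *)

theory Defs
  imports Complex_Main "HOL-Algebra.Coset"
begin

section \<open>Complex inner product spaces and unitary operators\<close>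

record 'v ip_space = "'v partial_object" +
  vadd :: "'v \<Rightarrow> 'v \<Rightarrow> 'v"
  vscale :: "complex \<Rightarrow> 'v \<Rightarrow> 'v"
  vinner :: "'v \<Rightarrow> 'v \<Rightarrow> complex"

definition linear_operator :: "'v ip_space \<Rightarrow> 'w ip_space \<Rightarrow> ('v \<Rightarrow> 'w) \<Rightarrow> bool" where
  "linear_operator V W T \<longleftrightarrow>
     T \<in> carrier V \<rightarrow> carrier W \<and>
     (\<forall>u\<in>carrier V. \<forall>v\<in>carrier V. T (vadd V u v) = vadd W (T u) (T v)) \<and>
     (\<forall>c. \<forall>v\<in>carrier V. T (vscale V c v) = vscale W c (T v))"

definition unitary_operator :: "'v ip_space \<Rightarrow> 'w ip_space \<Rightarrow> ('v \<Rightarrow> 'w) \<Rightarrow> bool" where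
  "unitary_operator V W T \<longleftrightarrow>
     linear_operator V W T \<and>
     bij_betw T (carrier V) (carrier W) \<and>
     (\<forall>u\<in>carrier V. \<forall>v\<in>carrier V. vinner W (T u) (T v) = vinner V u v)"

definition unitary_group :: "'v ip_space \<Rightarrow> ('v \<Rightarrow> 'v) monoid" where
  "unitary_group V =
     \<lparr>carrier = {T \<in> extensional (carrier V). unitary_operator V V T},
      mult = compose (carrier V),
      one = (\<lambda>v\<in>carrier V. v)\<rparr>"

definition unitary_representation ::
    "('a, 'b) monoid_scheme \<Rightarrow> 'v ip_space \<Rightarrow> ('a \<Rightarrow> 'v \<Rightarrow> 'v) \<Rightarrow> bool" where
  "unitary_representation G V \<pi> \<longleftrightarrow> \<pi> \<in> hom G (unitary_group V)"

definition intertwines ::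
    "('a, 'b) monoid_scheme \<Rightarrow> 'v ip_space \<Rightarrow>
     ('a \<Rightarrow> 'v \<Rightarrow> 'v) \<Rightarrow> ('a \<Rightarrow> 'w \<Rightarrow> 'w) \<Rightarrow> ('v \<Rightarrow> 'w) \<Rightarrow> bool" where
  "intertwines G V \<pi> \<sigma> T \<longleftrightarrow> (\<forall>x\<in>carrier G. \<forall>v\<in>carrier V. T (\<pi> x v) = \<sigma> x (T v))"

section \<open>The dual group\<close>

definition circle_group :: "complex monoid" where
  "circle_group = \<lparr>carrier = {z. cmod z = 1}, mult = (*), one = 1\<rparr>"

text \<open>Functions on a carrier set are taken to be extensional (equal to \<open>undefined\<close> off
  the carrier), so that functions that agree on the carrier are equal and, for instance,
  each character is counted exactly once.\<close>

definition dual_group :: "('a, 'b) monoid_scheme \<Rightarrow> ('a \<Rightarrow> complex) monoid" where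
  "dual_group K =
     \<lparr>carrier = hom K circle_group \<inter> extensional (carrier K),
      mult = (\<lambda>\<alpha> \<beta>. \<lambda>h\<in>carrier K. \<alpha> h * \<beta> h),
      one = (\<lambda>h\<in>carrier K. 1)\<rparr>"

abbreviation subgroup_dual :: "('a, 'b) monoid_scheme \<Rightarrow> 'a set \<Rightarrow> ('a \<Rightarrow> complex) set" where
  "subgroup_dual G H \<equiv> carrier (dual_group (G\<lparr>carrier := H\<rparr>))"

section \<open>The spaces and the representations\<close>

definition L2 :: "('a, 'b) monoid_scheme \<Rightarrow> ('a \<Rightarrow> complex) ip_space" where
  "L2 G =
     \<lparr>carrier = extensional (carrier G),
      vadd = (\<lambda>f g. \<lambda>x\<in>carrier G. f x + g x),
      vscale = (\<lambda>c f. \<lambda>x\<in>carrier G. c * f x),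
      vinner = (\<lambda>f g. \<Sum>x\<in>carrier G. f x * cnj (g x))\<rparr>"

definition left_regular ::
    "('a, 'b) monoid_scheme \<Rightarrow> 'a \<Rightarrow> ('a \<Rightarrow> complex) \<Rightarrow> 'a \<Rightarrow> complex" where
  "left_regular G x = (\<lambda>f\<in>carrier (L2 G). \<lambda>y\<in>carrier G. f (inv\<^bsub>G\<^esub> x \<otimes>\<^bsub>G\<^esub> y))"

definition ind_space ::
    "('a, 'b) monoid_scheme \<Rightarrow> 'a set \<Rightarrow> ('a \<Rightarrow> complex) \<Rightarrow> ('a \<Rightarrow> complex) ip_space" where
  "ind_space G H \<alpha> =
     \<lparr>carrier = {f \<in> carrier (L2 G).
        \<forall>x\<in>carrier G. \<forall>h\<in>H. f (x \<otimes>\<^bsub>G\<^esub> h) = cnj (\<alpha> h) * f x},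
      vadd = vadd (L2 G),
      vscale = vscale (L2 G),
      vinner = (\<lambda>f g. 1 / of_nat (card H) * (\<Sum>x\<in>carrier G. f x * cnj (g x)))\<rparr>"

definition induced_rep ::
    "('a, 'b) monoid_scheme \<Rightarrow> 'a set \<Rightarrow> ('a \<Rightarrow> complex) \<Rightarrow>
     'a \<Rightarrow> ('a \<Rightarrow> complex) \<Rightarrow> 'a \<Rightarrow> complex" where
  "induced_rep G H \<alpha> x =
     (\<lambda>f\<in>carrier (ind_space G H \<alpha>). \<lambda>y\<in>carrier G. f (inv\<^bsub>G\<^esub> x \<otimes>\<^bsub>G\<^esub> y))"

text \<open>Direct integrals are taken over a finite index set with normalised counting measure.\<close>

definition direct_integral :: "'i set \<Rightarrow> ('i \<Rightarrow> 'v ip_space) \<Rightarrow> ('i \<Rightarrow> 'v) ip_space" where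
  "direct_integral A V =
     \<lparr>carrier = (\<Pi>\<^sub>E \<alpha>\<in>A. carrier (V \<alpha>)),
      vadd = (\<lambda>\<phi> \<psi>. \<lambda>\<alpha>\<in>A. vadd (V \<alpha>) (\<phi> \<alpha>) (\<psi> \<alpha>)),
      vscale = (\<lambda>c \<phi>. \<lambda>\<alpha>\<in>A. vscale (V \<alpha>) c (\<phi> \<alpha>)),
      vinner = (\<lambda>\<phi> \<psi>. 1 / of_nat (card A) * (\<Sum>\<alpha>\<in>A. vinner (V \<alpha>) (\<phi> \<alpha>) (\<psi> \<alpha>)))\<rparr>"

definition direct_integral_rep ::
    "'i set \<Rightarrow> ('i \<Rightarrow> 'v ip_space) \<Rightarrow> ('i \<Rightarrow> 'a \<Rightarrow> 'v \<Rightarrow> 'v) \<Rightarrow>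
     'a \<Rightarrow> ('i \<Rightarrow> 'v) \<Rightarrow> 'i \<Rightarrow> 'v" where
  "direct_integral_rep A V \<pi> x =
     (\<lambda>\<phi>\<in>carrier (direct_integral A V). \<lambda>\<beta>\<in>A. \<pi> \<beta> x (\<phi> \<beta>))"

section \<open>The Zak transform\<close>

definition zak ::
    "('a, 'b) monoid_scheme \<Rightarrow> 'a set \<Rightarrow>
     ('a \<Rightarrow> complex) \<Rightarrow> ('a \<Rightarrow> complex) \<Rightarrow> 'a \<Rightarrow> complex" where
  "zak G H f =
     (\<lambda>\<alpha>\<in>subgroup_dual G H. \<lambda>x\<in>carrier G.
        \<Sum>h\<in>H. f (x \<otimes>\<^bsub>G\<^esub> h) * \<alpha> h)"

section \<open>Consistency of the definitions\<close>

lemma unitary_representationI: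
  fixes G (structure)
  assumes G: "group G"
    and ext: "\<And>x. x \<in> carrier G \<Longrightarrow> \<pi> x \<in> extensional (carrier V)"
    and lin: "\<And>x. x \<in> carrier G \<Longrightarrow> linear_operator V V (\<pi> x)"
    and ip: "\<And>x u v. \<lbrakk>x \<in> carrier G; u \<in> carrier V; v \<in> carrier V\<rbrakk>
      \<Longrightarrow> vinner V (\<pi> x u) (\<pi> x v) = vinner V u v"
    and one: "\<And>v. v \<in> carrier V \<Longrightarrow> \<pi> \<one> v = v"
    and mult: "\<And>x y v. \<lbrakk>x \<in> carrier G; y \<in> carrier G; v \<in> carrier V\<rbrakk>
      \<Longrightarrow> \<pi> (x \<otimes> y) v = \<pi> x (\<pi> y v)"
  shows "unitary_representation G V \<pi>"
proof -
  interpret group G by (fact G)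
  have closed: "\<pi> x v \<in> carrier V" if "x \<in> carrier G" "v \<in> carrier V" for x v
    using lin[OF that(1)] that(2) by (auto simp: linear_operator_def)
  have bij: "bij_betw (\<pi> x) (carrier V) (carrier V)" if x: "x \<in> carrier G" for x
  proof (rule bij_betw_byWitness[where f' = "\<pi> (inv x)"])
    show "\<forall>v\<in>carrier V. \<pi> (inv x) (\<pi> x v) = v"
      using x one mult[of "inv x" x] by simp
    show "\<forall>v\<in>carrier V. \<pi> x (\<pi> (inv x) v) = v"
      using x one mult[of x "inv x"] by simp
  qed (use x closed in auto)
  have eq: "\<pi> (x \<otimes> y) = compose (carrier V) (\<pi> x) (\<pi> y)"
    if "x \<in> carrier G" "y \<in> carrier G" for x y
    by (rule extensionalityI[where A = "carrier V"])
      (use that ext mult in \<open>auto simp: compose_def\<close>)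
  show ?thesis
    unfolding unitary_representation_def hom_def unitary_group_def unitary_operator_def
    using ext lin ip bij eq by auto
qed

lemma sum_left_translate:
  fixes G (structure)
  assumes "group G" "x \<in> carrier G"
  shows "(\<Sum>y\<in>carrier G. g (inv x \<otimes> y)) = (\<Sum>y\<in>carrier G. g y)"
proof -
  interpret group G by (fact assms(1))
  show ?thesis
    by (rule sum.reindex_bij_witness[where j = "\<lambda>y. inv x \<otimes> y" and i = "\<lambda>y. x \<otimes> y"])
      (use assms(2) in \<open>auto simp: m_assoc[symmetric]\<close>)
qed

lemma unitary_representation_left_regular:
  fixes G (structure)
  assumes "group G"
  shows "unitary_representation G (L2 G) (left_regular G)"
proof -
  interpret group G by (fact assms)
  show ?thesis
  proof (rule unitary_representationI[OF assms])
    fix x u v assume "x \<in> carrier G" "u \<in> carrier (L2 G)" "v \<in> carrier (L2 G)"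
    then show "vinner (L2 G) (left_regular G x u) (left_regular G x v) = vinner (L2 G) u v"
      using sum_left_translate[OF assms, of x "\<lambda>y. u y * cnj (v y)"]
      by (simp add: L2_def left_regular_def)
  next
    fix x assume x: "x \<in> carrier G"
    then show "linear_operator (L2 G) (L2 G) (left_regular G x)"
      by (auto simp: linear_operator_def L2_def left_regular_def fun_eq_iff)
  next
    fix v assume "v \<in> carrier (L2 G)"
    then show "left_regular G \<one> v = v"
      by (auto simp: L2_def left_regular_def fun_eq_iff extensional_def)
  next
    fix x y v assume "x \<in> carrier G" "y \<in> carrier G" "v \<in> carrier (L2 G)"
    then show "left_regular G (x \<otimes> y) v = left_regular G x (left_regular G y v)"
      by (auto simp: L2_def left_regular_def fun_eq_iff inv_mult_group m_assoc)
  qed (simp add: left_regular_def)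
qed

lemma unitary_representation_induced_rep:
  fixes G (structure)
  assumes "group G" "subgroup H G"
  shows "unitary_representation G (ind_space G H \<alpha>) (induced_rep G H \<alpha>)"
proof -
  interpret group G by (fact assms(1))
  have H: "h \<in> carrier G" if "h \<in> H" for h
    using subgroup.mem_carrier[OF assms(2) that] .
  show ?thesis
  proof (rule unitary_representationI[OF assms(1)])
    fix x u v assume "x \<in> carrier G" "u \<in> carrier (ind_space G H \<alpha>)" "v \<in> carrier (ind_space G H \<alpha>)"
    then show "vinner (ind_space G H \<alpha>) (induced_rep G H \<alpha> x u) (induced_rep G H \<alpha> x v)
        = vinner (ind_space G H \<alpha>) u v"
      using sum_left_translate[OF assms(1), of x "\<lambda>y. u y * cnj (v y)"]
      by (simp add: ind_space_def induced_rep_def)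
  next
    fix x assume x: "x \<in> carrier G"
    then show "linear_operator (ind_space G H \<alpha>) (ind_space G H \<alpha>) (induced_rep G H \<alpha> x)"
      by (auto simp: linear_operator_def L2_def ind_space_def induced_rep_def fun_eq_iff
          H m_assoc[symmetric] distrib_left)
  next
    fix v assume "v \<in> carrier (ind_space G H \<alpha>)"
    then show "induced_rep G H \<alpha> \<one> v = v"
      by (auto simp: L2_def ind_space_def induced_rep_def fun_eq_iff extensional_def)
  next
    fix x y v assume "x \<in> carrier G" "y \<in> carrier G" "v \<in> carrier (ind_space G H \<alpha>)"
    then show "induced_rep G H \<alpha> (x \<otimes> y) v = induced_rep G H \<alpha> x (induced_rep G H \<alpha> y v)"
      by (auto simp: L2_def ind_space_def induced_rep_def fun_eq_iff inv_mult_group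
          H m_assoc[symmetric])
  qed (simp add: induced_rep_def)
qed

lemma unitary_representation_direct_integral:
  fixes G (structure)
  assumes G: "group G"
    and rep: "\<And>\<alpha>. \<alpha> \<in> A \<Longrightarrow> unitary_representation G (V \<alpha>) (\<pi> \<alpha>)"
    and add: "\<And>\<alpha> u v. \<lbrakk>\<alpha> \<in> A; u \<in> carrier (V \<alpha>); v \<in> carrier (V \<alpha>)\<rbrakk>
      \<Longrightarrow> vadd (V \<alpha>) u v \<in> carrier (V \<alpha>)"
    and scale: "\<And>\<alpha> c v. \<lbrakk>\<alpha> \<in> A; v \<in> carrier (V \<alpha>)\<rbrakk> \<Longrightarrow> vscale (V \<alpha>) c v \<in> carrier (V \<alpha>)"
  shows "unitary_representation G (direct_integral A V) (direct_integral_rep A V \<pi>)"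
proof -
  interpret group G by (fact G)
  have U: "unitary_operator (V \<alpha>) (V \<alpha>) (\<pi> \<alpha> x)" if "\<alpha> \<in> A" "x \<in> carrier G" for \<alpha> x
    using rep[OF that(1)] that(2)
    by (auto simp: unitary_representation_def unitary_group_def hom_def)
  have mult: "\<pi> \<alpha> (x \<otimes> y) v = \<pi> \<alpha> x (\<pi> \<alpha> y v)"
    if "\<alpha> \<in> A" "x \<in> carrier G" "y \<in> carrier G" "v \<in> carrier (V \<alpha>)" for \<alpha> x y v
    using rep[OF that(1)] that(2-)
    by (auto simp: unitary_representation_def unitary_group_def hom_def compose_def)
  have closed: "\<pi> \<alpha> x v \<in> carrier (V \<alpha>)"
    if "\<alpha> \<in> A" "x \<in> carrier G" "v \<in> carrier (V \<alpha>)" for \<alpha> x v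
    using U[OF that(1,2)] that(3) by (auto simp: unitary_operator_def linear_operator_def)
  have one: "\<pi> \<alpha> \<one> v = v" if "\<alpha> \<in> A" "v \<in> carrier (V \<alpha>)" for \<alpha> v
  proof -
    have "inj_on (\<pi> \<alpha> \<one>) (carrier (V \<alpha>))"
      using U[of \<alpha> \<one>] that by (auto simp: unitary_operator_def bij_betw_def)
    then show ?thesis
      using mult[of \<alpha> \<one> \<one> v] closed[of \<alpha> \<one> v] that by (auto dest: inj_onD)
  qed
  show ?thesis
  proof (rule unitary_representationI[OF G])
    fix x u v
    assume "x \<in> carrier G" "u \<in> carrier (direct_integral A V)" "v \<in> carrier (direct_integral A V)"
    then show "vinner (direct_integral A V) (direct_integral_rep A V \<pi> x u)
        (direct_integral_rep A V \<pi> x v) = vinner (direct_integral A V) u v"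
      using U by (simp add: direct_integral_def direct_integral_rep_def
          unitary_operator_def PiE_iff cong: sum.cong)
  next
    fix x assume "x \<in> carrier G"
    then show "linear_operator (direct_integral A V) (direct_integral A V) (direct_integral_rep A V \<pi> x)"
      using U closed add scale
      by (auto simp: linear_operator_def direct_integral_def direct_integral_rep_def
          unitary_operator_def PiE_iff fun_eq_iff)
  next
    fix v assume "v \<in> carrier (direct_integral A V)"
    then show "direct_integral_rep A V \<pi> \<one> v = v"
      using one by (auto simp: direct_integral_def direct_integral_rep_def PiE_iff
          fun_eq_iff extensional_def)
  next
    fix x y v assume "x \<in> carrier G" "y \<in> carrier G" "v \<in> carrier (direct_integral A V)"
    then show "direct_integral_rep A V \<pi> (x \<otimes> y) v
        = direct_integral_rep A V \<pi> x (direct_integral_rep A V \<pi> y v)"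
      using mult closed by (auto simp: direct_integral_def direct_integral_rep_def PiE_iff
          fun_eq_iff)
  qed (simp add: direct_integral_rep_def)
qed

corollary unitary_representation_direct_integral_induced:
  fixes G (structure)
  assumes "group G" "subgroup H G"
  shows "unitary_representation G (direct_integral (subgroup_dual G H) (ind_space G H))
    (direct_integral_rep (subgroup_dual G H) (ind_space G H) (induced_rep G H))"
proof -
  interpret group G by (fact assms(1))
  have "h \<in> carrier G" if "h \<in> H" for h
    using subgroup.mem_carrier[OF assms(2) that] .
  then show ?thesis
    using assms unitary_representation_induced_rep
    by (intro unitary_representation_direct_integral)
      (auto simp: ind_space_def L2_def distrib_left)
qed

text \<open>The inner product of an induced space as a sum over a transversal of the left cosets.\<close>

lemma vinner_ind_space_transversal:
  fixes G (structure)
  assumes "group G" "finite (carrier G)" "subgroup H G"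
    and \<alpha>: "\<alpha> \<in> subgroup_dual G H"
    and \<Omega>: "\<Omega> \<subseteq> carrier G" "\<And>x. x \<in> carrier G \<Longrightarrow> \<exists>!w. w \<in> \<Omega> \<and> x \<in> w <# H"
    and f: "f \<in> carrier (ind_space G H \<alpha>)" and g: "g \<in> carrier (ind_space G H \<alpha>)"
  shows "vinner (ind_space G H \<alpha>) f g = (\<Sum>x\<in>\<Omega>. f x * cnj (g x))"
proof -
  interpret group G by (fact assms(1))
  have H: "h \<in> carrier G" if "h \<in> H" for h
    using subgroup.mem_carrier[OF assms(3) that] .
  have finH: "finite H" using assms(2,3) finite_subset subgroup.subset by blast
  have cardH: "card H \<noteq> 0" using finH subgroup.one_closed[OF assms(3)] by auto
  have unit: "\<alpha> h * cnj (\<alpha> h) = 1" if "h \<in> H" for h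
  proof -
    have "cmod (\<alpha> h) = 1" using \<alpha> that by (auto simp: dual_group_def circle_group_def hom_def)
    then show ?thesis by (simp add: complex_norm_square[symmetric])
  qed
  have bij: "bij_betw (\<lambda>(w, h). w \<otimes> h) (\<Omega> \<times> H) (carrier G)"
    unfolding bij_betw_def
  proof
    show "inj_on (\<lambda>(w, h). w \<otimes> h) (\<Omega> \<times> H)"
    proof (rule inj_onI, clarify)
      fix w h w' h'
      assume *: "w \<in> \<Omega>" "h \<in> H" "w' \<in> \<Omega>" "h' \<in> H" "w \<otimes> h = w' \<otimes> h'"
      then have c: "w \<in> carrier G" "w' \<in> carrier G" using \<Omega>(1) by auto
      have "w \<otimes> h \<in> w <# H" using *(2) by (auto simp: l_coset_def)
      moreover have "w \<otimes> h \<in> w' <# H" unfolding *(5) using *(4) by (auto simp: l_coset_def)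
      moreover have "w \<otimes> h \<in> carrier G" using c(1) H[OF *(2)] by (rule m_closed)
      ultimately have w: "w = w'" using \<Omega>(2)[of "w \<otimes> h"] *(1,3) by (blast elim: ex1E)
      have "h = h'" using *(5) c(2) H[OF *(2)] H[OF *(4)] unfolding w by simp
      with w show "w = w' \<and> h = h'" by simp
    qed
    show "(\<lambda>(w, h). w \<otimes> h) ` (\<Omega> \<times> H) = carrier G"
    proof
      show "(\<lambda>(w, h). w \<otimes> h) ` (\<Omega> \<times> H) \<subseteq> carrier G" using \<Omega>(1) H by auto
      show "carrier G \<subseteq> (\<lambda>(w, h). w \<otimes> h) ` (\<Omega> \<times> H)"
      proof
        fix x assume "x \<in> carrier G"
        then obtain w where "w \<in> \<Omega>" "x \<in> w <# H" using \<Omega>(2) by meson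
        then obtain h where "h \<in> H" "x = w \<otimes> h" unfolding l_coset_def by blast
        with \<open>w \<in> \<Omega>\<close> show "x \<in> (\<lambda>(w, h). w \<otimes> h) ` (\<Omega> \<times> H)" by force
      qed
    qed
  qed
  have "(\<Sum>x\<in>carrier G. f x * cnj (g x))
      = (\<Sum>(w, h)\<in>\<Omega> \<times> H. f (w \<otimes> h) * cnj (g (w \<otimes> h)))"
    using sum.reindex_bij_betw[OF bij, of "\<lambda>x. f x * cnj (g x)"] by (simp add: case_prod_unfold)
  also have "\<dots> = (\<Sum>(w, h)\<in>\<Omega> \<times> H. f w * cnj (g w))"
  proof (rule sum.cong, simp, clarify)
    fix w h assume *: "w \<in> \<Omega>" "h \<in> H"
    then have "f (w \<otimes> h) = cnj (\<alpha> h) * f w" "g (w \<otimes> h) = cnj (\<alpha> h) * g w"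
      using f g \<Omega>(1) by (auto simp: ind_space_def)
    then have "f (w \<otimes> h) * cnj (g (w \<otimes> h)) = (\<alpha> h * cnj (\<alpha> h)) * (f w * cnj (g w))"
      by simp
    then show "f (w \<otimes> h) * cnj (g (w \<otimes> h)) = f w * cnj (g w)" using unit * by simp
  qed
  also have "\<dots> = of_nat (card H) * (\<Sum>w\<in>\<Omega>. f w * cnj (g w))"
    by (simp add: sum.cartesian_product[symmetric] sum_distrib_left)
  finally show ?thesis using cardH by (simp add: ind_space_def)
qed

end

theory Submission
  imports Defs "HOL-Algebra.Multiplicative_Group"
begin

text \<open>A character of a subgroup \<open>K\<close> of a finite abelian group extends to the subgroup generated
  by \<open>K\<close> and \<open>x\<close>, with any prescribed value \<open>z\<close> at \<open>x\<close> such that \<open>z ^ m = \<chi> (x ^ m)\<close>, where \<open>m\<close> is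
  the order of \<open>x\<close> modulo \<open>K\<close>. Hence characters separate points, and translating sums over the
  group and over its dual gives both orthogonality relations. The relation over the dual makes
  the Zak transform isometric; the one over \<open>H\<close> makes
  \<open>\<phi> \<mapsto> (x \<mapsto> 1 / |H| * (\<Sum>\<alpha>. \<phi> \<alpha> x))\<close> a right inverse. It intertwines because left and right
  translations commute.\<close>

section \<open>Characters of finite abelian groups\<close>

lemma hom_circle_group_iff:
  "\<chi> \<in> hom K circle_group \<longleftrightarrow>
    (\<forall>k\<in>carrier K. cmod (\<chi> k) = 1) \<and>
    (\<forall>k\<in>carrier K. \<forall>l\<in>carrier K. \<chi> (k \<otimes>\<^bsub>K\<^esub> l) = \<chi> k * \<chi> l)"
  by (auto simp: hom_def circle_group_def)

lemma hom_circle_group_one: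
  assumes "group K" "\<chi> \<in> hom K circle_group"
  shows "\<chi> \<one>\<^bsub>K\<^esub> = 1"
proof -
  interpret group K by fact
  have "\<chi> (\<one>\<^bsub>K\<^esub> \<otimes>\<^bsub>K\<^esub> \<one>\<^bsub>K\<^esub>) = \<chi> \<one>\<^bsub>K\<^esub> * \<chi> \<one>\<^bsub>K\<^esub>" "cmod (\<chi> \<one>\<^bsub>K\<^esub>) = 1"
    using assms(2) one_closed unfolding hom_circle_group_iff by blast+
  moreover from this have "\<chi> \<one>\<^bsub>K\<^esub> \<noteq> 0" by auto
  ultimately show ?thesis by simp
qed

lemma hom_circle_group_pow:
  fixes n :: nat
  assumes "group K" "\<chi> \<in> hom K circle_group" "k \<in> carrier K"
  shows "\<chi> (k [^]\<^bsub>K\<^esub> n) = \<chi> k ^ n"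
proof -
  interpret group K by fact
  show ?thesis
    using assms(2,3) hom_circle_group_one[OF assms(1,2)]
    by (induction n) (auto simp: hom_circle_group_iff)
qed

lemma hom_circle_group_mult_cnj:
  assumes "\<chi> \<in> hom K circle_group" "k \<in> carrier K"
  shows "\<chi> k * cnj (\<chi> k) = 1"
  using assms by (simp add: hom_circle_group_iff complex_norm_square[symmetric])

lemma hom_circle_group_inv:
  assumes "group K" "\<chi> \<in> hom K circle_group" "k \<in> carrier K"
  shows "\<chi> (inv\<^bsub>K\<^esub> k) = cnj (\<chi> k)"
proof -
  interpret group K by fact
  have "\<chi> k * \<chi> (inv\<^bsub>K\<^esub> k) = \<chi> (k \<otimes>\<^bsub>K\<^esub> inv\<^bsub>K\<^esub> k)"
    using assms(2,3) inv_closed[OF assms(3)] unfolding hom_circle_group_iff by metis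
  also have "\<dots> = \<chi> k * cnj (\<chi> k)"
    using assms by (simp add: hom_circle_group_one hom_circle_group_mult_cnj)
  finally show ?thesis
    using assms(2,3) by (auto simp: hom_circle_group_iff)
qed

section \<open>Extending a character by one group element\<close>

definition rel_ord :: "('a, 'b) monoid_scheme \<Rightarrow> 'a set \<Rightarrow> 'a \<Rightarrow> nat" where
  "rel_ord G K x = (LEAST d. 0 < d \<and> x [^]\<^bsub>G\<^esub> d \<in> K)"

text \<open>Division with remainder: if \<open>x [^] d\<close> lies in \<open>K\<close>, then so
  does \<open>x [^] (d mod m)\<close>, being a quotient of two elements of \<open>K\<close>, and
  minimality of \<open>m\<close> forces the remainder to be 0.\<close>

lemma (in group) rel_ord_props:
  assumes "finite (carrier G)" "subgroup K G" "x \<in> carrier G"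
  shows rel_ord_pos: "0 < rel_ord G K x"
    and pow_mem_iff_rel_ord_dvd: "x [^] (d::nat) \<in> K \<longleftrightarrow> rel_ord G K x dvd d"
proof -
  interpret K: subgroup K G by fact
  define m where "m = rel_ord G K x"
  \<comment> \<open>The group order is an admissible exponent, so the \<open>LEAST\<close> is
    attained.\<close>
  have "0 < order G \<and> x [^] order G \<in> K"
    using assms pow_order_eq_1 order_gt_0_iff_finite by simp
  then have m: "0 < m \<and> x [^] m \<in> K"
    unfolding m_def rel_ord_def by (rule LeastI)
  then show "0 < rel_ord G K x" by (simp add: m_def)
  have mult: "x [^] (m * q) \<in> K" for q :: nat
    by (induction q) (use m assms(3) in \<open>auto simp: nat_pow_mult[symmetric] add.commute\<close>)
  show "x [^] d \<in> K \<longleftrightarrow> rel_ord G K x dvd d"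
    unfolding m_def[symmetric]
  proof
    assume d: "x [^] d \<in> K"
    have "x [^] d = x [^] (m * (d div m)) \<otimes> x [^] (d mod m)"
      using assms(3) by (simp add: nat_pow_mult)
    then have "x [^] (d mod m) = inv (x [^] (m * (d div m))) \<otimes> x [^] d"
      using assms(3) by (simp add: inv_solve_left)
    then have "x [^] (d mod m) \<in> K"
      using d mult by simp
    then have "\<not> 0 < d mod m"
      using not_less_Least[of "d mod m" "\<lambda>d. 0 < d \<and> x [^] d \<in> K"] m
      by (auto simp: m_def rel_ord_def)
    then show "m dvd d" by auto
  next
    assume "m dvd d"
    then show "x [^] d \<in> K" using mult by auto
  qed
qed

text \<open>The extension has to send \<open>k \<otimes> x [^] i\<close> to
  \<open>\<chi> k * z ^ i\<close>. Two such representations of one element differ by a power of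
  \<open>x\<close> lying in \<open>K\<close>, and there the condition on \<open>z\<close> makes
  \<chi> agree with the powers of \<open>z\<close>.\<close>

lemma (in comm_group) extend_character:
  assumes fin: "finite (carrier G)" and K: "subgroup K G"
    and \<chi>: "\<chi> \<in> hom (G\<lparr>carrier := K\<rparr>) circle_group"
    and x: "x \<in> carrier G" and z: "z ^ rel_ord G K x = \<chi> (x [^] rel_ord G K x)"
  obtains K' \<chi>' where "subgroup K' G" "K \<subseteq> K'" "x \<in> K'"
    "\<chi>' \<in> hom (G\<lparr>carrier := K'\<rparr>) circle_group" "\<And>k. k \<in> K \<Longrightarrow> \<chi>' k = \<chi> k" "\<chi>' x = z"
proof -
  interpret K: subgroup K G by (fact K)
  define m where "m = rel_ord G K x"
  have m: "0 < m" and dvd: "x [^] (d::nat) \<in> K \<longleftrightarrow> m dvd d" for d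
    using rel_ord_pos[OF fin K x] pow_mem_iff_rel_ord_dvd[OF fin K x] by (simp_all add: m_def)
  have KG: "group (G\<lparr>carrier := K\<rparr>)" using K by (rule subgroup_imp_group)
  have norm: "cmod (\<chi> k) = 1" if "k \<in> K" for k
    using \<chi> that by (simp add: hom_circle_group_iff)
  have mult: "\<chi> (k \<otimes> l) = \<chi> k * \<chi> l" if "k \<in> K" "l \<in> K" for k l
    using \<chi> that by (simp add: hom_circle_group_iff)
  have one: "\<chi> \<one> = 1" using hom_circle_group_one[OF KG \<chi>] by simp
  have xm: "x [^] m \<in> K" by (simp add: dvd)
  have "cmod z ^ m = 1" using z xm norm by (simp add: norm_power[symmetric] m_def)
  then have nz: "cmod z = 1" using m power_eq_imp_eq_base[of "cmod z" m 1] by simp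
  have pow: "\<chi> (x [^] d) = z ^ d" if "x [^] d \<in> K" for d :: nat
  proof -
    from that obtain q where "d = m * q" by (auto simp: dvd)
    then show ?thesis
      using hom_circle_group_pow[OF KG \<chi>, of "x [^] m" q] xm z x
      by (simp add: nat_pow_pow power_mult m_def nat_pow_consistent[symmetric])
  qed
  \<comment> \<open>Assuming \<open>i \<le> j\<close> keeps the difference of exponents a natural
    number; the other case exchanges the two representations.\<close>
  have wd: "\<chi> k * z ^ i = \<chi> l * z ^ j"
    if "i \<le> j" "k \<in> K" "l \<in> K" "k \<otimes> x [^] i = l \<otimes> x [^] j" for k l and i j :: nat
  proof -
    have "k \<otimes> x [^] i = (l \<otimes> x [^] (j - i)) \<otimes> x [^] i"
      using that x by (simp add: m_assoc nat_pow_mult)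
    then have k: "k = l \<otimes> x [^] (j - i)"
      using that x by simp
    then have "x [^] (j - i) = inv l \<otimes> k"
      using that x by (simp add: inv_solve_left)
    then have mem: "x [^] (j - i) \<in> K" using that by simp
    have "\<chi> k = \<chi> l * z ^ (j - i)"
      using mult[OF that(3) mem] pow[OF mem] k by simp
    then show ?thesis using that(1) by (simp add: power_add[symmetric])
  qed
  define rep where "rep g p \<longleftrightarrow> fst p \<in> K \<and> g = fst p \<otimes> x [^] (snd p :: nat)" for g p
  define K' where "K' = K <#> generate G {x}"
  \<comment> \<open>An arbitrary representation of \<open>g\<close> is evaluated; \<open>val\<close>
    shows, through \<open>wd\<close>, that the choice is immaterial.\<close>
  define \<chi>' where "\<chi>' g = (let p = SOME p. rep g p in \<chi> (fst p) * z ^ snd p)" for g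
  \<comment> \<open>Natural exponents suffice because \<open>x\<close> has finite order, so its
    inverse is one of its powers.\<close>
  have K'_iff: "g \<in> K' \<longleftrightarrow> (\<exists>k\<in>K. \<exists>i::nat. g = k \<otimes> x [^] i)" for g
    unfolding K'_def generate_pow_on_finite_carrier[OF fin x] set_mult_def by auto
  have val: "\<chi>' (k \<otimes> x [^] i) = \<chi> k * z ^ i" if "k \<in> K" for k and i :: nat
  proof -
    define p where "p = (SOME p. rep (k \<otimes> x [^] i) p)"
    have "rep (k \<otimes> x [^] i) p"
      unfolding p_def by (rule someI[of _ "(k, i)"]) (use that in \<open>simp add: rep_def\<close>)
    then have "\<chi> (fst p) * z ^ snd p = \<chi> k * z ^ i"
      using wd[of i "snd p" k "fst p"] wd[of "snd p" i "fst p" k] that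
      by (cases "i \<le> snd p") (auto simp: rep_def)
    then show ?thesis by (simp add: \<chi>'_def p_def Let_def)
  qed
  show thesis
  proof (rule that[of K' \<chi>'])
    show "subgroup K' G"
      unfolding K'_def using x by (intro mult_subgroups K generate_is_subgroup) auto
    show "K \<subseteq> K'"
    proof
      fix k assume "k \<in> K"
      then show "k \<in> K'" unfolding K'_iff by (intro bexI[of _ k] exI[of _ 0]) auto
    qed
    show "x \<in> K'"
      unfolding K'_iff using x by (intro bexI[of _ \<one>] exI[of _ 1]) auto
    show "\<chi>' k = \<chi> k" if "k \<in> K" for k
      using val[OF that, of 0] that by simp
    show "\<chi>' x = z"
      using val[OF K.one_closed, of 1] x by (simp add: one)
    have "cmod (\<chi>' g) = 1" if "g \<in> K'" for g
      using that by (auto simp: K'_iff val norm_mult norm_power norm nz)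
    moreover have "\<chi>' (g \<otimes> h) = \<chi>' g * \<chi>' h" if gh: "g \<in> K'" "h \<in> K'" for g h
    proof -
      obtain k i l j where *: "k \<in> K" "g = k \<otimes> x [^] (i::nat)" "l \<in> K" "h = l \<otimes> x [^] (j::nat)"
        using gh by (auto simp: K'_iff)
      then have "g \<otimes> h = (k \<otimes> l) \<otimes> x [^] (i + j)"
        using x by (simp add: nat_pow_mult[symmetric] m_ac)
      then show ?thesis
        using * by (simp add: val mult power_add)
    qed
    ultimately show "\<chi>' \<in> hom (G\<lparr>carrier := K'\<rparr>) circle_group"
      by (simp add: hom_circle_group_iff)
  qed
qed

section \<open>Characters separate points\<close>

lemma exists_nth_root:
  assumes "n > 0"
  obtains z :: complex where "z ^ n = c"
proof (cases "c = 0")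
  case True
  then show ?thesis using that[of 0] assms by simp
next
  case False
  then have "card {z. z ^ n = c} > 0" using card_nth_roots[OF False assms] assms by simp
  then show ?thesis using that by (auto simp: card_gt_0_iff)
qed

text \<open>Among the subgroups that contain \<open>a\<close> and carry a character not equal to 1
  at \<open>a\<close>, one that is maximal under inclusion is all of \<open>G\<close>, since any
  further element could be adjoined by extending the character.\<close>

lemma (in comm_group) dual_group_separates:
  assumes fin: "finite (carrier G)" and a: "a \<in> carrier G" "a \<noteq> \<one>"
  obtains \<chi> where "\<chi> \<in> carrier (dual_group G)" "\<chi> a \<noteq> 1"
proof -
  define P where "P K \<longleftrightarrow> subgroup K G \<and> a \<in> K \<and>
    (\<exists>\<chi>. \<chi> \<in> hom (G\<lparr>carrier := K\<rparr>) circle_group \<and> \<chi> a \<noteq> 1)" for K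
  \<comment> \<open>The order of \<open>a\<close> is at least 2, so there is a value \<open>z \<noteq> 1\<close> to which the trivial character
    of the trivial subgroup can be extended.\<close>
  obtain K0 where K0: "P K0"
  proof -
    let ?m = "rel_ord G {\<one>} a"
    have "0 < ?m" "\<not> ?m dvd 1"
      using rel_ord_pos[OF fin triv_subgroup a(1)]
        pow_mem_iff_rel_ord_dvd[OF fin triv_subgroup a(1), of 1] a by auto
    then have "card {z::complex. z ^ ?m = 1} \<noteq> 1" "1 \<in> {z::complex. z ^ ?m = 1}"
      by (auto simp: card_nth_roots)
    then obtain z :: complex where z: "z ^ ?m = 1" "z \<noteq> 1"
      by (metis (mono_tags, lifting) is_singletonI' is_singleton_altdef mem_Collect_eq empty_iff)
    have "(\<lambda>_. 1) \<in> hom (G\<lparr>carrier := {\<one>}\<rparr>) circle_group"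
      by (simp add: hom_circle_group_iff)
    then obtain K \<chi> where "subgroup K G" "a \<in> K" "\<chi> \<in> hom (G\<lparr>carrier := K\<rparr>) circle_group" "\<chi> a = z"
      using extend_character[OF fin triv_subgroup _ a(1) z(1)] by metis
    then have "P K" using z(2) by (auto simp: P_def)
    then show ?thesis by (rule that)
  qed
  have sub: "{K. P K} \<subseteq> Pow (carrier G)"
    by (auto simp: P_def dest: subgroup.mem_carrier)
  then have "finite {K. P K}"
    using fin by (rule finite_subset[OF _ finite_Pow_iff[THEN iffD2]])
  then obtain K where "P K" and max: "\<And>L. P L \<Longrightarrow> K \<subseteq> L \<Longrightarrow> L = K"
    using finite_has_maximal[of "{K. P K}"] K0 by auto
  then obtain \<chi> where K: "subgroup K G" "a \<in> K"
    and \<chi>: "\<chi> \<in> hom (G\<lparr>carrier := K\<rparr>) circle_group" "\<chi> a \<noteq> 1"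
    by (auto simp: P_def)
  have "x \<in> K" if x: "x \<in> carrier G" for x
  proof -
    \<comment> \<open>Any root will do: \<open>a\<close> already lies in \<open>K\<close>, so the
      value at \<open>a\<close> survives every extension.\<close>
    obtain z where "z ^ rel_ord G K x = \<chi> (x [^] rel_ord G K x)"
      using exists_nth_root[OF rel_ord_pos[OF fin K(1) x]] by blast
    from extend_character[OF fin K(1) \<chi>(1) x this]
    obtain K' \<chi>' where K': "subgroup K' G" "K \<subseteq> K'" "x \<in> K'"
      "\<chi>' \<in> hom (G\<lparr>carrier := K'\<rparr>) circle_group" "\<And>k. k \<in> K \<Longrightarrow> \<chi>' k = \<chi> k"
      by metis
    then have "P K'"
      unfolding P_def using K(2) \<chi>(2) by (metis subsetD)
    then show ?thesis using max K' by blast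
  qed
  then have "K = carrier G"
    using K(1) by (auto dest: subgroup.mem_carrier)
  \<comment> \<open>Elements of the dual group are extensional, hence the restriction.\<close>
  then have "restrict \<chi> (carrier G) \<in> carrier (dual_group G)"
    using \<chi>(1) by (simp add: dual_group_def hom_circle_group_iff)
  then show thesis
    using that \<chi>(2) a(1) by (metis restrict_apply')
qed

section \<open>Finiteness of the dual and the orthogonality relations\<close>

text \<open>The values of a character are roots of unity whose exponent is the group order, so only
  finitely many functions qualify.\<close>

lemma finite_dual_group:
  assumes "group K" "finite (carrier K)"
  shows "finite (carrier (dual_group K))"
proof (rule finite_subset)
  interpret group K by fact
  show "carrier (dual_group K) \<subseteq> carrier K \<rightarrow>\<^sub>E {z. z ^ order K = 1}"
  proof
    fix \<chi> assume "\<chi> \<in> carrier (dual_group K)"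
    then have \<chi>: "\<chi> \<in> hom K circle_group" "\<chi> \<in> extensional (carrier K)"
      by (auto simp: dual_group_def)
    have "\<chi> k ^ order K = 1" if "k \<in> carrier K" for k
      using hom_circle_group_pow[OF assms(1) \<chi>(1) that, of "order K"] that
        hom_circle_group_one[OF assms(1) \<chi>(1)] by (simp add: pow_order_eq_1)
    then show "\<chi> \<in> carrier K \<rightarrow>\<^sub>E {z. z ^ order K = 1}"
      using \<chi>(2) by (simp add: PiE_iff)
  qed
  have "order K > 0" using assms order_gt_0_iff_finite by simp
  then show "finite (carrier K \<rightarrow>\<^sub>E {z::complex. z ^ order K = 1})"
    using assms(2) by (intro finite_PiE finite_nth_roots)
qed

text \<open>Reindexing along \<open>t\<close> multiplies the sum by \<open>c\<close>. This serves
  both orthogonality relations: \<open>t\<close> is a translation of the group in one and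
  multiplication by a character in the other.\<close>

lemma sum_eq_0_if_scaled:
  fixes f :: "'a \<Rightarrow> complex"
  assumes "bij_betw t A A" "\<And>x. x \<in> A \<Longrightarrow> f (t x) = c * f x" "c \<noteq> 1"
  shows "sum f A = 0"
proof -
  have "sum f A = (\<Sum>x\<in>A. f (t x))" using sum.reindex_bij_betw[OF assms(1), of f] by simp
  also have "\<dots> = c * sum f A" using assms(2) by (simp add: sum_distrib_left)
  finally show ?thesis using assms(3) by simp
qed

lemma sum_character:
  assumes "group K" "\<chi> \<in> hom K circle_group"
  shows "(\<Sum>k\<in>carrier K. \<chi> k) = (if \<forall>k\<in>carrier K. \<chi> k = 1 then of_nat (card (carrier K)) else 0)"
proof (cases "\<forall>k\<in>carrier K. \<chi> k = 1")
  case True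
  then show ?thesis by simp
next
  case False
  interpret group K by fact
  obtain a where a: "a \<in> carrier K" "\<chi> a \<noteq> 1" using False by auto
  have "bij_betw (\<lambda>k. a \<otimes>\<^bsub>K\<^esub> k) (carrier K) (carrier K)"
    by (rule bij_betw_byWitness[where f' = "\<lambda>k. inv\<^bsub>K\<^esub> a \<otimes>\<^bsub>K\<^esub> k"])
      (use a in \<open>auto simp: m_assoc[symmetric]\<close>)
  then have "(\<Sum>k\<in>carrier K. \<chi> k) = 0"
    by (rule sum_eq_0_if_scaled[where c = "\<chi> a"]) (use a assms(2) in \<open>auto simp: hom_circle_group_iff\<close>)
  then show ?thesis using False by (simp only: if_False)
qed

text \<open>The summand is itself a character. Its values have modulus 1, so it is trivial exactly
  when \<alpha> and \<beta> coincide.\<close>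

lemma character_orthogonality:
  assumes "group K" "\<alpha> \<in> carrier (dual_group K)" "\<beta> \<in> carrier (dual_group K)"
  shows "(\<Sum>k\<in>carrier K. cnj (\<alpha> k) * \<beta> k) = (if \<alpha> = \<beta> then of_nat (card (carrier K)) else 0)"
proof -
  have ab: "\<alpha> \<in> hom K circle_group" "\<beta> \<in> hom K circle_group"
    "\<alpha> \<in> extensional (carrier K)" "\<beta> \<in> extensional (carrier K)"
    using assms by (auto simp: dual_group_def)
  have "(\<lambda>k. cnj (\<alpha> k) * \<beta> k) \<in> hom K circle_group"
    using ab by (simp add: hom_circle_group_iff norm_mult)
  moreover have "(\<forall>k\<in>carrier K. cnj (\<alpha> k) * \<beta> k = 1) \<longleftrightarrow> \<alpha> = \<beta>"
  proof
    assume *: "\<forall>k\<in>carrier K. cnj (\<alpha> k) * \<beta> k = 1"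
    show "\<alpha> = \<beta>"
    proof (rule extensionalityI[OF ab(3,4)])
      fix k assume k: "k \<in> carrier K"
      have "\<alpha> k = \<alpha> k * (cnj (\<alpha> k) * \<beta> k)" using * k by simp
      also have "\<dots> = \<beta> k" using hom_circle_group_mult_cnj[OF ab(1) k] by simp
      finally show "\<alpha> k = \<beta> k" .
    qed
  next
    assume "\<alpha> = \<beta>"
    then show "\<forall>k\<in>carrier K. cnj (\<alpha> k) * \<beta> k = 1"
      using hom_circle_group_mult_cnj[OF ab(1)] by (simp add: mult.commute)
  qed
  ultimately show ?thesis using sum_character[OF assms(1)] by simp
qed

text \<open>For \<open>a \<noteq> \<one>\<close>, multiplication by a character \<chi> with
  \<open>\<chi> a \<noteq> 1\<close> permutes the dual and scales evaluation at \<open>a\<close> by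
  \<open>\<chi> a\<close>.\<close>

lemma (in comm_group) sum_dual_group:
  assumes "finite (carrier G)" "a \<in> carrier G"
  shows "(\<Sum>\<alpha>\<in>carrier (dual_group G). \<alpha> a)
    = (if a = \<one> then of_nat (card (carrier (dual_group G))) else 0)"
proof (cases "a = \<one>")
  case True
  have "\<alpha> \<one> = 1" if "\<alpha> \<in> carrier (dual_group G)" for \<alpha>
    using that hom_circle_group_one[OF is_group] by (auto simp: dual_group_def)
  then have "(\<Sum>\<alpha>\<in>carrier (dual_group G). \<alpha> \<one>) = (\<Sum>\<alpha>\<in>carrier (dual_group G). 1)"
    by (rule sum.cong[OF refl])
  then show ?thesis using True by simp
next
  case False
  obtain \<chi> where \<chi>: "\<chi> \<in> carrier (dual_group G)" "\<chi> a \<noteq> 1"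
    using dual_group_separates[OF assms False] .
  have unit: "\<chi> k * (cnj (\<chi> k) * c) = c" "cnj (\<chi> k) * (\<chi> k * c) = c"
    if "k \<in> carrier G" for k c
    using hom_circle_group_mult_cnj[of \<chi> G k] \<chi>(1) that
    by (simp_all add: dual_group_def mult.assoc[symmetric] mult.commute[of "cnj (\<chi> k)"])
  have "bij_betw (\<lambda>\<alpha>. \<lambda>k\<in>carrier G. \<chi> k * \<alpha> k) (carrier (dual_group G)) (carrier (dual_group G))"
  proof (rule bij_betw_byWitness[where f' = "\<lambda>\<alpha>. \<lambda>k\<in>carrier G. cnj (\<chi> k) * \<alpha> k"])
    show "\<forall>\<alpha>\<in>carrier (dual_group G).
        (\<lambda>k\<in>carrier G. cnj (\<chi> k) * (\<lambda>k\<in>carrier G. \<chi> k * \<alpha> k) k) = \<alpha>"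
      by (auto simp: dual_group_def fun_eq_iff extensional_def unit)
    show "\<forall>\<alpha>\<in>carrier (dual_group G).
        (\<lambda>k\<in>carrier G. \<chi> k * (\<lambda>k\<in>carrier G. cnj (\<chi> k) * \<alpha> k) k) = \<alpha>"
      by (auto simp: dual_group_def fun_eq_iff extensional_def unit)
  qed (use \<chi>(1) in \<open>auto simp: dual_group_def hom_circle_group_iff norm_mult\<close>)
  then have "(\<Sum>\<alpha>\<in>carrier (dual_group G). \<alpha> a) = 0"
    by (rule sum_eq_0_if_scaled[where c = "\<chi> a"]) (use assms \<chi>(2) in auto)
  then show ?thesis using False by simp
qed

lemma (in comm_group) card_dual_group:
  assumes "finite (carrier G)"
  shows "card (carrier (dual_group G)) = card (carrier G)"
proof -
  \<comment> \<open>Evaluate the sum of all \<open>\<alpha> k\<close> in both orders.\<close>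
  let ?D = "carrier (dual_group G)" and ?e = "\<lambda>k\<in>carrier G. 1 :: complex"
  have e: "?e \<in> ?D" by (simp add: dual_group_def hom_circle_group_iff)
  have finD: "finite ?D" using finite_dual_group[OF is_group assms] .
  have "of_nat (card (carrier G)) = (\<Sum>\<alpha>\<in>?D. if ?e = \<alpha> then of_nat (card (carrier G)) else (0::complex))"
    using e finD by simp
  also have "\<dots> = (\<Sum>\<alpha>\<in>?D. \<Sum>k\<in>carrier G. \<alpha> k)"
  proof (rule sum.cong)
    fix \<alpha> assume "\<alpha> \<in> ?D"
    from character_orthogonality[OF is_group e this]
    show "(if ?e = \<alpha> then of_nat (card (carrier G)) else (0::complex)) = (\<Sum>k\<in>carrier G. \<alpha> k)"
      by simp
  qed simp
  also have "\<dots> = (\<Sum>k\<in>carrier G. \<Sum>\<alpha>\<in>?D. \<alpha> k)"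
    by (rule sum.swap)
  also have "\<dots> = of_nat (card ?D)"
    using assms by (simp add: sum_dual_group cong: sum.cong)
  finally show ?thesis by (simp only: of_nat_eq_iff)
qed

text \<open>Conjugation inverts on the unit circle, so the summand is \<alpha> evaluated at
  \<open>h \<otimes> inv k\<close>.\<close>

lemma (in comm_group) character_orthogonality_dual:
  assumes "finite (carrier G)" "h \<in> carrier G" "k \<in> carrier G"
  shows "(\<Sum>\<alpha>\<in>carrier (dual_group G). \<alpha> h * cnj (\<alpha> k))
    = (if h = k then of_nat (card (carrier (dual_group G))) else 0)"
proof -
  have "\<alpha> h * cnj (\<alpha> k) = \<alpha> (h \<otimes> inv k)" if "\<alpha> \<in> carrier (dual_group G)" for \<alpha>
    using that assms(2,3) hom_circle_group_inv[OF is_group, of \<alpha> k]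
    by (simp add: dual_group_def hom_circle_group_iff)
  then have "(\<Sum>\<alpha>\<in>carrier (dual_group G). \<alpha> h * cnj (\<alpha> k))
      = (\<Sum>\<alpha>\<in>carrier (dual_group G). \<alpha> (h \<otimes> inv k))"
    by (rule sum.cong[OF refl])
  also have "\<dots> = (if h \<otimes> inv k = \<one> then of_nat (card (carrier (dual_group G))) else 0)"
    using assms by (intro sum_dual_group) auto
  also have "h \<otimes> inv k = \<one> \<longleftrightarrow> h = k"
    using assms inv_solve_right'[of \<one> h k] by auto
  finally show ?thesis .
qed

section \<open>The Zak transform\<close>

lemma (in group) sum_right_translate:
  assumes "h \<in> carrier G"
  shows "(\<Sum>x\<in>carrier G. f (x \<otimes> h)) = (\<Sum>x\<in>carrier G. f x)"
  by (rule sum.reindex_bij_witness[where j = "\<lambda>x. x \<otimes> h" and i = "\<lambda>x. x \<otimes> inv h"])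
    (use assms in \<open>auto simp: m_assoc\<close>)

text \<open>Commutativity is assumed of \<open>H\<close> alone: the results on characters are
  applied to \<open>H\<close>, while sums over \<open>G\<close> are only translated.\<close>

locale finite_group_abelian_subgroup = group G for G (structure) +
  fixes H :: "'a set"
  assumes finite_carrier: "finite (carrier G)"
    and subgroup: "subgroup H G"
    and abelian: "comm_group (G\<lparr>carrier := H\<rparr>)"
begin

sublocale H: subgroup H G by (fact subgroup)

abbreviation HG where "HG \<equiv> G\<lparr>carrier := H\<rparr>"
abbreviation dual where "dual \<equiv> subgroup_dual G H"

lemma group_HG: "group HG"
  using abelian by (rule comm_group.axioms)

lemma finite_H: "finite H"
  using finite_carrier H.subset by (rule finite_subset[rotated])

text \<open>This turns the normalising factor of the direct integral into
  \<open>1 / card H\<close>.\<close>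

lemma card_dual: "card dual = card H"
  using comm_group.card_dual_group[OF abelian] finite_H by simp

lemma card_H_nonzero: "of_nat (card H) \<noteq> (0 :: complex)"
  using finite_H H.subset H.one_closed by (metis card_eq_0_iff empty_iff of_nat_eq_0_iff)

lemma finite_dual: "finite dual"
  using finite_dual_group[OF group_HG] finite_H by simp

lemma dual_mult: "\<lbrakk>\<alpha> \<in> dual; h \<in> H; k \<in> H\<rbrakk> \<Longrightarrow> \<alpha> (h \<otimes> k) = \<alpha> h * \<alpha> k"
  by (simp add: dual_group_def hom_circle_group_iff)

lemma dual_one: "\<alpha> \<in> dual \<Longrightarrow> \<alpha> \<one> = 1"
  using hom_circle_group_one[OF group_HG, of \<alpha>] by (simp add: dual_group_def)

lemma dual_mult_cnj: "\<lbrakk>\<alpha> \<in> dual; h \<in> H\<rbrakk> \<Longrightarrow> \<alpha> h * cnj (\<alpha> h) = 1"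
  using hom_circle_group_mult_cnj[of \<alpha> HG h] by (simp add: dual_group_def)

lemma orthogonality:
  "\<lbrakk>\<alpha> \<in> dual; \<beta> \<in> dual\<rbrakk> \<Longrightarrow> (\<Sum>h\<in>H. cnj (\<alpha> h) * \<beta> h) = (if \<alpha> = \<beta> then of_nat (card H) else 0)"
  using character_orthogonality[OF group_HG, of \<alpha> \<beta>] by simp

lemma orthogonality_dual:
  "\<lbrakk>h \<in> H; k \<in> H\<rbrakk> \<Longrightarrow> (\<Sum>\<alpha>\<in>dual. \<alpha> h * cnj (\<alpha> k)) = (if h = k then of_nat (card H) else 0)"
  using comm_group.character_orthogonality_dual[OF abelian, of h k] finite_H card_dual by simp

section \<open>Covariance and linearity of the Zak transform\<close>

lemma zak_apply:
  "\<lbrakk>\<alpha> \<in> dual; x \<in> carrier G\<rbrakk> \<Longrightarrow> zak G H f \<alpha> x = (\<Sum>h\<in>H. f (x \<otimes> h) * \<alpha> h)"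
  by (simp add: zak_def)

text \<open>Shift the summation variable by \<open>h\<close>; the character then contributes the
  factor \<open>cnj (\<alpha> h)\<close>.\<close>

lemma zak_covariant:
  assumes "\<alpha> \<in> dual" "x \<in> carrier G" "h \<in> H"
  shows "zak G H f \<alpha> (x \<otimes> h) = cnj (\<alpha> h) * zak G H f \<alpha> x"
proof -
  have "zak G H f \<alpha> (x \<otimes> h) = (\<Sum>k\<in>H. f (x \<otimes> (h \<otimes> k)) * \<alpha> k)"
    using assms by (simp add: zak_apply m_assoc)
  also have "\<dots> = (\<Sum>k\<in>H. cnj (\<alpha> h) * (f (x \<otimes> (h \<otimes> k)) * \<alpha> (h \<otimes> k)))"
  proof (rule sum.cong[OF refl])
    fix k assume k: "k \<in> H"
    have "cnj (\<alpha> h) * (f (x \<otimes> (h \<otimes> k)) * \<alpha> (h \<otimes> k))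
        = (\<alpha> h * cnj (\<alpha> h)) * (f (x \<otimes> (h \<otimes> k)) * \<alpha> k)"
      by (simp only: dual_mult[OF assms(1,3) k] mult_ac)
    then show "f (x \<otimes> (h \<otimes> k)) * \<alpha> k = cnj (\<alpha> h) * (f (x \<otimes> (h \<otimes> k)) * \<alpha> (h \<otimes> k))"
      by (simp only: dual_mult_cnj[OF assms(1,3)] mult_1_left)
  qed
  also have "\<dots> = (\<Sum>k\<in>H. cnj (\<alpha> h) * (f (x \<otimes> k) * \<alpha> k))"
    by (rule sum.reindex_bij_witness[where j = "\<lambda>k. h \<otimes> k" and i = "\<lambda>k. inv h \<otimes> k"])
      (use assms(3) in \<open>auto simp: m_assoc[symmetric]\<close>)
  also have "\<dots> = cnj (\<alpha> h) * zak G H f \<alpha> x"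
    using assms by (simp add: zak_apply sum_distrib_left)
  finally show ?thesis .
qed

lemma zak_mem: "zak G H f \<in> carrier (direct_integral dual (ind_space G H))"
  using zak_covariant[of _ _ _ f]
  by (auto simp: direct_integral_def ind_space_def L2_def PiE_iff zak_def extensional_def)

lemma linear_operator_zak:
  "linear_operator (L2 G) (direct_integral dual (ind_space G H)) (zak G H)"
  unfolding linear_operator_def
proof (intro conjI ballI allI)
  show "zak G H \<in> carrier (L2 G) \<rightarrow> carrier (direct_integral dual (ind_space G H))"
    using zak_mem by blast
qed (auto simp: direct_integral_def ind_space_def L2_def zak_def fun_eq_iff
    sum.distrib sum_distrib_left distrib_right mult.assoc)

section \<open>Isometry, inversion and intertwining\<close>

text \<open>Summing over the dual first leaves the diagonal \<open>h = k\<close> with a factor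
  \<open>card H\<close>. The remaining sum over \<open>H\<close> consists of equal terms and gives a
  second such factor; the normalisations of the direct integral and of the induced spaces cancel
  both.\<close>

lemma vinner_zak:
  "vinner (direct_integral dual (ind_space G H)) (zak G H f) (zak G H g) = vinner (L2 G) f g"
proof -
  let ?c = "of_nat (card H) :: complex"
  have "(\<Sum>\<alpha>\<in>dual. \<Sum>x\<in>carrier G. zak G H f \<alpha> x * cnj (zak G H g \<alpha> x))
      = (\<Sum>\<alpha>\<in>dual. \<Sum>x\<in>carrier G. \<Sum>h\<in>H. \<Sum>k\<in>H.
          f (x \<otimes> h) * cnj (g (x \<otimes> k)) * (\<alpha> h * cnj (\<alpha> k)))"
    by (simp add: zak_apply sum_product mult_ac)
  also have "\<dots> = (\<Sum>x\<in>carrier G. \<Sum>h\<in>H. \<Sum>k\<in>H. \<Sum>\<alpha>\<in>dual.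
          f (x \<otimes> h) * cnj (g (x \<otimes> k)) * (\<alpha> h * cnj (\<alpha> k)))"
    \<comment> \<open>Fixing the outer index set lets rewriting push the sum over
      \<open>dual\<close> to the innermost place and stop there.\<close>
    by (simp only: sum.swap[of _ _ dual])
  also have "\<dots> = (\<Sum>x\<in>carrier G. \<Sum>h\<in>H. \<Sum>k\<in>H.
          f (x \<otimes> h) * cnj (g (x \<otimes> k)) * (if h = k then ?c else 0))"
    by (simp add: sum_distrib_left[symmetric] orthogonality_dual del: mult_eq_0_iff)
  also have "\<dots> = (\<Sum>x\<in>carrier G. \<Sum>h\<in>H. f (x \<otimes> h) * cnj (g (x \<otimes> h)) * ?c)"
    using finite_H by (simp add: if_distrib[of "\<lambda>t. _ * t"] cong: if_cong)
  also have "\<dots> = (\<Sum>h\<in>H. \<Sum>x\<in>carrier G. f (x \<otimes> h) * cnj (g (x \<otimes> h)) * ?c)"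
    by (rule sum.swap)
  also have "\<dots> = (\<Sum>h\<in>H. \<Sum>x\<in>carrier G. f x * cnj (g x) * ?c)"
    by (intro sum.cong[OF refl] sum_right_translate) auto
  also have "\<dots> = ?c * ?c * vinner (L2 G) f g"
    by (simp add: L2_def sum_distrib_left mult_ac)
  finally show ?thesis
    using card_H_nonzero
    by (simp add: direct_integral_def ind_space_def card_dual sum_divide_distrib[symmetric]
        del: of_nat_eq_0_iff)
qed

text \<open>On each coset of \<open>H\<close> the transform is a Fourier transform of
  \<open>\<lambda>h. f (x \<otimes> h)\<close>, so it is undone by Fourier inversion evaluated at
  \<open>h = \<one>\<close>.\<close>

lemma bij_betw_zak:
  "bij_betw (zak G H) (carrier (L2 G)) (carrier (direct_integral dual (ind_space G H)))"
proof (rule bij_betw_byWitness)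
  let ?c = "of_nat (card H) :: complex"
  let ?inv = "\<lambda>\<phi>. \<lambda>x\<in>carrier G. 1 / ?c * (\<Sum>\<alpha>\<in>dual. \<phi> \<alpha> x)"
  show "zak G H ` carrier (L2 G) \<subseteq> carrier (direct_integral dual (ind_space G H))"
    using zak_mem by blast
  show "?inv ` carrier (direct_integral dual (ind_space G H)) \<subseteq> carrier (L2 G)"
    by (auto simp: L2_def)
  show "\<forall>f\<in>carrier (L2 G). ?inv (zak G H f) = f"
  proof
    fix f assume "f \<in> carrier (L2 G)"
    then have f: "f \<in> extensional (carrier G)" by (simp add: L2_def)
    have "(\<Sum>\<alpha>\<in>dual. zak G H f \<alpha> x) = ?c * f x" if x: "x \<in> carrier G" for x
    proof -
      \<comment> \<open>The inserted factor is 1; it brings the sum into the form of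
        \<open>orthogonality_dual\<close> with \<open>k = \<one>\<close>.\<close>
      have "(\<Sum>\<alpha>\<in>dual. zak G H f \<alpha> x) = (\<Sum>\<alpha>\<in>dual. \<Sum>h\<in>H. f (x \<otimes> h) * (\<alpha> h * cnj (\<alpha> \<one>)))"
        using x by (simp add: zak_apply dual_one)
      also have "\<dots> = (\<Sum>h\<in>H. f (x \<otimes> h) * (\<Sum>\<alpha>\<in>dual. \<alpha> h * cnj (\<alpha> \<one>)))"
        by (simp add: sum.swap[of _ _ dual] sum_distrib_left)
      also have "\<dots> = (\<Sum>h\<in>H. if h = \<one> then f (x \<otimes> h) * ?c else 0)"
        by (intro sum.cong[OF refl]) (simp add: orthogonality_dual)
      also have "\<dots> = ?c * f x"
        using finite_H x by simp
      finally show ?thesis .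
    qed
    then show "?inv (zak G H f) = f"
      using card_H_nonzero f by (auto simp: fun_eq_iff extensional_def)
  qed
  show "\<forall>\<phi>\<in>carrier (direct_integral dual (ind_space G H)). zak G H (?inv \<phi>) = \<phi>"
  proof
    fix \<phi> assume \<phi>: "\<phi> \<in> carrier (direct_integral dual (ind_space G H))"
    then have cov: "\<phi> \<alpha> (x \<otimes> h) = cnj (\<alpha> h) * \<phi> \<alpha> x"
      if "\<alpha> \<in> dual" "x \<in> carrier G" "h \<in> H" for \<alpha> x h
      using that by (auto simp: direct_integral_def ind_space_def PiE_iff)
    show "zak G H (?inv \<phi>) = \<phi>"
    proof (rule extensionalityI[where A = dual])
      show "zak G H (?inv \<phi>) \<in> extensional dual" by (simp add: zak_def)
      show "\<phi> \<in> extensional dual" using \<phi> by (auto simp: direct_integral_def PiE_iff)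
      fix \<beta> assume \<beta>: "\<beta> \<in> dual"
      show "zak G H (?inv \<phi>) \<beta> = \<phi> \<beta>"
      proof (rule extensionalityI[where A = "carrier G"])
        show "zak G H (?inv \<phi>) \<beta> \<in> extensional (carrier G)" using \<beta> by (simp add: zak_def)
        show "\<phi> \<beta> \<in> extensional (carrier G)"
          using \<phi> \<beta> by (auto simp: direct_integral_def ind_space_def L2_def PiE_iff)
        fix x assume x: "x \<in> carrier G"
        \<comment> \<open>Covariance takes \<open>h\<close> out of the argument of
          \<open>\<phi> \<alpha>\<close>, so that the sum over \<open>H\<close> compares \<alpha>
          with \<beta> and orthogonality selects \<beta>.\<close>
        have "zak G H (?inv \<phi>) \<beta> x
            = (\<Sum>h\<in>H. 1 / ?c * (\<Sum>\<alpha>\<in>dual. \<phi> \<alpha> x * (cnj (\<alpha> h) * \<beta> h)))"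
          using \<beta> x by (simp add: zak_apply cov sum_distrib_left sum_distrib_right mult_ac)
        also have "\<dots> = 1 / ?c * (\<Sum>\<alpha>\<in>dual. \<phi> \<alpha> x * (\<Sum>h\<in>H. cnj (\<alpha> h) * \<beta> h))"
          by (simp only: sum_distrib_left[symmetric] sum.swap[of _ dual H])
        also have "\<dots> = 1 / ?c * (\<Sum>\<alpha>\<in>dual. if \<alpha> = \<beta> then \<phi> \<alpha> x * ?c else 0)"
          using \<beta> by (intro arg_cong2[where f = "(*)"] sum.cong refl) (simp add: orthogonality)
        also have "\<dots> = \<phi> \<beta> x"
          using \<beta> finite_dual card_H_nonzero by simp
        finally show "zak G H (?inv \<phi>) \<beta> x = \<phi> \<beta> x" .
      qed
    qed
  qed
qed

text \<open>By associativity, translating by \<open>inv x\<close> on the left commutes with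
  multiplying by \<open>h\<close> on the right.\<close>

lemma intertwines_zak:
  "intertwines G (L2 G) (left_regular G)
    (direct_integral_rep dual (ind_space G H) (induced_rep G H)) (zak G H)"
  unfolding intertwines_def
proof (intro ballI)
  fix x f assume x: "x \<in> carrier G" and f: "f \<in> carrier (L2 G)"
  \<comment> \<open>\<open>induced_rep\<close> is restricted to its space, so it unfolds only on
    members.\<close>
  have mem: "zak G H f \<alpha> \<in> carrier (ind_space G H \<alpha>)" if "\<alpha> \<in> dual" for \<alpha>
    using zak_mem[of f] that by (auto simp: direct_integral_def PiE_iff)
  show "zak G H (left_regular G x f)
      = direct_integral_rep dual (ind_space G H) (induced_rep G H) x (zak G H f)"
  proof (rule extensionalityI[where A = dual])
    show "zak G H (left_regular G x f) \<in> extensional dual" by (simp add: zak_def)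
    show "direct_integral_rep dual (ind_space G H) (induced_rep G H) x (zak G H f) \<in> extensional dual"
      using zak_mem by (simp add: direct_integral_rep_def)
    fix \<alpha> assume \<alpha>: "\<alpha> \<in> dual"
    have "direct_integral_rep dual (ind_space G H) (induced_rep G H) x (zak G H f) \<alpha>
        = (\<lambda>y\<in>carrier G. zak G H f \<alpha> (inv x \<otimes> y))"
      using \<alpha> mem[OF \<alpha>] zak_mem by (simp add: direct_integral_rep_def induced_rep_def)
    also have "\<dots> = zak G H (left_regular G x f) \<alpha>"
      using x \<alpha> f by (auto simp: zak_def left_regular_def fun_eq_iff m_assoc)
    finally show "zak G H (left_regular G x f) \<alpha>
        = direct_integral_rep dual (ind_space G H) (induced_rep G H) x (zak G H f) \<alpha>" ..
  qed
qed

end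

theorem theorem1:
  fixes G :: "('a, 'b) monoid_scheme" and H :: "'a set"
  assumes "group G" and "finite (carrier G)"
    and "subgroup H G" and "comm_group (G\<lparr>carrier := H\<rparr>)"
  shows "unitary_operator (L2 G) (direct_integral (subgroup_dual G H) (ind_space G H)) (zak G H) \<and>
    intertwines G (L2 G) (left_regular G)
      (direct_integral_rep (subgroup_dual G H) (ind_space G H) (induced_rep G H)) (zak G H)"
proof -
  interpret finite_group_abelian_subgroup G H
    using assms by (simp add: finite_group_abelian_subgroup_def finite_group_abelian_subgroup_axioms_def)
  show ?thesis
    using linear_operator_zak bij_betw_zak vinner_zak intertwines_zak
    by (simp add: unitary_operator_def)
qed

end
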